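(* For every real $\tau\geq 0$ there exists a function $\psi:\mathbb{N}\to(0,1]$ such that $\psi$ is not eventually non-increasing, $\underline{\tau}_\psi=\tau$, and \[ \dim_H L(\psi)=0<\frac{1}{1+\underline{\tau}_\psi}, \] where $\underline{\tau}_\psi=\liminf_{q\to\infty}\frac{-\log\psi(q)}{\log q}$.
   Context: Every $x\in(0,1]$ has a unique Lüroth expansion $x=\sum_{k=1}^\infty \frac{1}{d_k\prod_{j=1}^{k-1}d_j(d_j-1)}$ with digits $d_k=d_k(x)\in\{2,3,4,\dots\}$. For $n\in\mathbb{N}$ define $Q_n(x)=d_n\prod_{j=1}^{n-1}d_j(d_j-1)$ (empty product $=1$) and $P_n(x)=Q_n(x)\sum_{k=1}^n \frac{1}{d_k\prod_{j=1}^{k-1}d_j(d_j-1)}$. For $\psi:\mathbb{N}\to(0,1]$, \[ L(\psi)=\limsup_{n\to\infty}\Big\{x\in(0,1]: \Big|x-\frac{P_n(x)}{Q_n(x)}\Big|<\frac{\psi(Q_n(x))}{Q_n(x)}\Big\}, \] the set of $x$ for which the inequality holds for infinitely many $n$. $\dim_H$ is Hausdorff dimension. *)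

theory Defs
  imports "HOL-Analysis.Analysis"
begin

(* Gauge diam^s: the empty set has gauge 0 for every s, and a nonempty set has gauge 1 for s = 0
   (Isabelle's 0 powr 0 is 0), so that the 0-dimensional measure is counting measure. *)
definition hausdorff_gauge :: "real \<Rightarrow> 'a::metric_space set \<Rightarrow> ennreal" where
  "hausdorff_gauge s U =
     (if U = {} then 0 else if s = 0 then 1 else ennreal (diameter U powr s))"

(* Boundedness is required because diameter is only meaningful for bounded sets. *)
definition hausdorff_premeasure :: "real \<Rightarrow> real \<Rightarrow> 'a::metric_space set \<Rightarrow> ennreal" where
  "hausdorff_premeasure s \<delta> A =
     Inf {(\<Sum>i. hausdorff_gauge s (U i)) | U :: nat \<Rightarrow> 'a set.
            A \<subseteq> (\<Union>i. U i) \<and> (\<forall>i. bounded (U i) \<and> diameter (U i) \<le> \<delta>)}"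

definition hausdorff_measure :: "real \<Rightarrow> 'a::metric_space set \<Rightarrow> ennreal" where
  "hausdorff_measure s A = (SUP \<delta>\<in>{0<..}. hausdorff_premeasure s \<delta> A)"

definition hausdorff_dim :: "'a::metric_space set \<Rightarrow> ereal" where
  "hausdorff_dim A = Inf {ereal s | s. 0 \<le> s \<and> hausdorff_measure s A = 0}"

(* Digit sequences are indexed from 1; entry 0 is a dummy. *)
definition luroth_denom :: "(nat \<Rightarrow> nat) \<Rightarrow> nat \<Rightarrow> nat" where
  "luroth_denom d n = d n * (\<Prod>j = 1..<n. d j * (d j - 1))"

definition luroth_expansion :: "(nat \<Rightarrow> nat) \<Rightarrow> real \<Rightarrow> bool" where
  "luroth_expansion d x \<longleftrightarrow>
     (\<forall>k\<ge>1. 2 \<le> d k) \<and> (\<lambda>k. 1 / real (luroth_denom d (Suc k))) sums x"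

(* The dummy entry is normalised to 0 to make the sequence unique;
   see luroth_expansion_unique_existence below. *)
definition luroth_digits :: "real \<Rightarrow> nat \<Rightarrow> nat" where
  "luroth_digits x = (THE d. d 0 = 0 \<and> luroth_expansion d x)"

definition luroth_Q :: "nat \<Rightarrow> real \<Rightarrow> nat" where
  "luroth_Q n x = luroth_denom (luroth_digits x) n"

definition luroth_P :: "nat \<Rightarrow> real \<Rightarrow> real" where
  "luroth_P n x =
     real (luroth_Q n x) * (\<Sum>k = 1..n. 1 / real (luroth_denom (luroth_digits x) k))"

definition luroth_L :: "(nat \<Rightarrow> real) \<Rightarrow> real set" where
  "luroth_L \<psi> = limsup (\<lambda>n. {x \<in> {0<..1}.
     \<bar>x - luroth_P n x / real (luroth_Q n x)\<bar> < \<psi> (luroth_Q n x) / real (luroth_Q n x)})"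

definition lower_order :: "(nat \<Rightarrow> real) \<Rightarrow> ereal" where
  "lower_order \<psi> = liminf (\<lambda>q. ereal (- ln (\<psi> q) / ln (real q)))"

lemma luroth_denom_1 [simp]: "luroth_denom d (Suc 0) = d 1"
  by (simp add: luroth_denom_def)

lemma luroth_denom_shift:
  "luroth_denom d (Suc (Suc k)) = d 1 * (d 1 - 1) * luroth_denom (\<lambda>k. d (Suc k)) (Suc k)"
proof -
  have "(\<Prod>j = 1..<Suc (Suc k). d j * (d j - 1))
      = d 1 * (d 1 - 1) * (\<Prod>j = Suc 1..<Suc (Suc k). d j * (d j - 1))"
    by (rule prod.atLeast_Suc_lessThan) simp
  also have "(\<Prod>j = Suc 1..<Suc (Suc k). d j * (d j - 1))
      = (\<Prod>j = 1..<Suc k. d (Suc j) * (d (Suc j) - 1))"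
    by (rule prod.shift_bounds_Suc_ivl)
  finally show ?thesis
    by (simp add: luroth_denom_def algebra_simps)
qed

lemma luroth_denom_pos:
  assumes "\<forall>k\<ge>1. 2 \<le> d k" "1 \<le> n"
  shows "0 < luroth_denom d n"
proof -
  have "0 < d j * (d j - 1)" if "1 \<le> j" for j
    using assms(1) that by (metis One_nat_def Suc_1 Suc_le_lessD less_le_trans mult_pos_pos
        zero_less_diff zero_less_Suc)
  moreover have "0 < d n"
    using assms by force
  ultimately show ?thesis
    unfolding luroth_denom_def by (intro mult_pos_pos prod_pos) auto
qed

lemma luroth_partial_le_1:
  assumes "\<forall>k\<ge>1. 2 \<le> d k"
  shows "(\<Sum>k<n. 1 / real (luroth_denom d (Suc k))) \<le> 1"
  using assms
proof (induction n arbitrary: d)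
  case (Suc n)
  let ?e = "\<lambda>k. d (Suc k)"
  let ?a = "real (d 1)"
  have d1: "2 \<le> d 1" using Suc.prems by simp
  then have a: "?a * (?a - 1) > 0" "real (d 1 * (d 1 - 1)) = ?a * (?a - 1)" "?a \<ge> 2"
    by (auto simp: of_nat_diff)
  have IH: "(\<Sum>k<n. 1 / real (luroth_denom ?e (Suc k))) \<le> 1"
    using Suc.prems by (intro Suc.IH) simp
  have "(\<Sum>k<Suc n. 1 / real (luroth_denom d (Suc k)))
      = 1 / ?a + (\<Sum>k<n. 1 / real (luroth_denom d (Suc (Suc k))))"
    by (subst sum.lessThan_Suc_shift) simp
  also have "(\<Sum>k<n. 1 / real (luroth_denom d (Suc (Suc k))))
      = (\<Sum>k<n. 1 / real (luroth_denom ?e (Suc k))) / (?a * (?a - 1))"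
    unfolding luroth_denom_shift of_nat_mult[of "d 1 * (d 1 - 1)"] a(2)
    by (simp add: sum_divide_distrib mult_ac)
  also have "\<dots> \<le> 1 / (?a * (?a - 1))"
    using IH a(1) by (intro divide_right_mono) auto
  also have "1 / ?a + 1 / (?a * (?a - 1)) = 1 / (?a - 1)"
    using a(3) by (simp add: field_simps)
  also have "\<dots> \<le> 1"
    using a(3) by simp
  finally show ?case by simp
qed simp

lemma luroth_expansion_bounds:
  assumes "luroth_expansion d x"
  shows "0 < x" "x \<le> 1"
proof -
  have d: "\<forall>k\<ge>1. 2 \<le> d k"
    and s: "(\<lambda>k. 1 / real (luroth_denom d (Suc k))) sums x"
    using assms by (auto simp: luroth_expansion_def)
  have pos: "0 < 1 / real (luroth_denom d (Suc k))" for k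
    using luroth_denom_pos[OF d, of "Suc k"] by simp
  show "0 < x"
    using suminf_pos[OF sums_summable[OF s] pos] sums_unique[OF s] by simp
  show "x \<le> 1"
    using s luroth_partial_le_1[OF d] unfolding sums_def
    by (intro LIMSEQ_le_const2[of _ x]) auto
qed

lemma luroth_expansion_shift:
  assumes "luroth_expansion d x"
  shows "luroth_expansion (\<lambda>k. d (Suc k)) (real (d 1) * (real (d 1) - 1) * (x - 1 / real (d 1)))"
proof -
  let ?e = "\<lambda>k. d (Suc k)"
  let ?a = "real (d 1)"
  have d: "\<forall>k\<ge>1. 2 \<le> d k"
    and s: "(\<lambda>k. 1 / real (luroth_denom d (Suc k))) sums x"
    using assms by (auto simp: luroth_expansion_def)
  have d1: "2 \<le> d 1" using d by simp
  then have a: "real (d 1 * (d 1 - 1)) = ?a * (?a - 1)" "?a * (?a - 1) \<noteq> 0"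
    by (auto simp: of_nat_diff)
  have "(\<lambda>k. 1 / real (luroth_denom d (Suc (Suc k)))) sums (x - 1 / ?a)"
    using s by (subst sums_Suc_iff) simp
  then have "(\<lambda>k. ?a * (?a - 1) * (1 / real (luroth_denom d (Suc (Suc k)))))
      sums (?a * (?a - 1) * (x - 1 / ?a))"
    by (rule sums_mult)
  also have "(\<lambda>k. ?a * (?a - 1) * (1 / real (luroth_denom d (Suc (Suc k)))))
      = (\<lambda>k. 1 / real (luroth_denom ?e (Suc k)))"
    unfolding luroth_denom_shift of_nat_mult[of "d 1 * (d 1 - 1)"] a(1)
    using a(2) by simp
  finally show ?thesis
    using d by (simp add: luroth_expansion_def)
qed

lemma luroth_first_digit:
  assumes "luroth_expansion d x"
  shows "d 1 = nat \<lfloor>1 / x\<rfloor> + 1"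
proof -
  let ?a = "real (d 1)"
  let ?y = "?a * (?a - 1) * (x - 1 / ?a)"
  have "2 \<le> d 1" using assms by (simp add: luroth_expansion_def)
  then have a: "?a \<ge> 2" by simp
  have y: "0 < ?y" "?y \<le> 1"
    using luroth_expansion_bounds[OF luroth_expansion_shift[OF assms]] by auto
  have x: "0 < x" using luroth_expansion_bounds[OF assms] by simp
  have y': "?y = (?a - 1) * (?a * x - 1)"
    using a by (simp add: field_simps)
  have "0 < ?a * x - 1"
    using y(1) a unfolding y' by (simp add: zero_less_mult_iff)
  then have 1: "1 / x < ?a"
    using x by (simp add: field_simps)
  have "?a * ((?a - 1) * x) \<le> ?a * 1"
    using y(2) unfolding y' by (simp add: algebra_simps)
  then have "(?a - 1) * x \<le> 1"
    using a by (subst (asm) mult_le_cancel_left_pos) auto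
  then have "?a - 1 \<le> 1 / x"
    using x by (simp add: field_simps)
  with 1 have "\<lfloor>1 / x\<rfloor> = int (d 1) - 1"
    by (intro floor_unique) auto
  then show ?thesis
    using \<open>2 \<le> d 1\<close> by simp
qed

lemma luroth_expansion_unique:
  assumes "luroth_expansion d x" "luroth_expansion e x"
  shows "d (Suc k) = e (Suc k)"
  using assms
proof (induction k arbitrary: d e x)
  case 0
  then show ?case using luroth_first_digit[of d x] luroth_first_digit[of e x] by simp
next
  case (Suc k)
  have "d 1 = e 1" using luroth_first_digit[OF Suc.prems(1)] luroth_first_digit[OF Suc.prems(2)] by simp
  then show ?case
    using Suc.IH[OF luroth_expansion_shift[OF Suc.prems(1)], of "\<lambda>k. e (Suc k)"]
      luroth_expansion_shift[OF Suc.prems(2)] by simp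
qed

definition luroth_map :: "real \<Rightarrow> real" where
  "luroth_map x = (let a = real (nat \<lfloor>1 / x\<rfloor> + 1) in a * (a - 1) * (x - 1 / a))"

lemma luroth_map_bounds:
  assumes "0 < x" "x \<le> 1"
  shows "0 < luroth_map x" "luroth_map x \<le> 1" "1 \<le> nat \<lfloor>1 / x\<rfloor>"
proof -
  define m where "m = nat \<lfloor>1 / x\<rfloor>"
  have "1 \<le> 1 / x" using assms by simp
  then have f: "1 \<le> \<lfloor>1 / x\<rfloor>" by (simp add: le_floor_iff)
  then show "1 \<le> nat \<lfloor>1 / x\<rfloor>" by linarith
  then have m1: "1 \<le> real m" unfolding m_def by linarith
  have "real m = of_int \<lfloor>1 / x\<rfloor>" unfolding m_def using f by linarith
  then have "real m \<le> 1 / x" "1 / x < real m + 1" by linarith+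
  then have b: "real m * x \<le> 1" "1 < (real m + 1) * x"
    using assms by (simp_all add: field_simps)
  have eq: "luroth_map x = real m * ((real m + 1) * x - 1)"
    unfolding luroth_map_def Let_def m_def[symmetric] using m1 by (simp add: field_simps)
  show "0 < luroth_map x"
    unfolding eq using b(2) m1 by simp
  have "(real m + 1) * (real m * x) \<le> (real m + 1) * 1"
    using b(1) by (intro mult_left_mono) auto
  then show "luroth_map x \<le> 1"
    unfolding eq by (simp add: algebra_simps)
qed

lemma luroth_expansion_exists:
  assumes "0 < x" "x \<le> 1"
  shows "\<exists>d. luroth_expansion d x"
proof -
  define t where "t n = (luroth_map ^^ n) x" for n
  define d where "d k = nat \<lfloor>1 / t (k - 1)\<rfloor> + 1" for k
  have t: "0 < t n \<and> t n \<le> 1" for n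
    by (induction n) (use assms luroth_map_bounds in \<open>auto simp: t_def\<close>)
  have d: "2 \<le> d k" for k
    using luroth_map_bounds(3)[of "t (k - 1)"] t[of "k - 1"] by (simp add: d_def)
  define R where "R n = (\<Prod>j = 1..<Suc n. d j * (d j - 1))" for n
  have R_Suc: "R (Suc n) = R n * (d (Suc n) * (d (Suc n) - 1))" for n
    by (simp add: R_def)
  have R_ge: "2 ^ n \<le> R n" for n
  proof (induction n)
    case (Suc n)
    have "2 * 1 \<le> d (Suc n) * (d (Suc n) - 1)"
      using d[of "Suc n"] by (intro mult_le_mono) auto
    with Suc have "2 ^ n * 2 \<le> R n * (d (Suc n) * (d (Suc n) - 1))"
      by (intro mult_le_mono) auto
    then show ?case by (simp add: R_Suc mult.commute)
  qed (simp add: R_def)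
  have R_pos: "0 < real (R n)" for n
    using less_le_trans[OF _ R_ge[of n], of 0] by simp
  have t_Suc: "t (Suc n) = real (d (Suc n)) * (real (d (Suc n)) - 1) * (t n - 1 / real (d (Suc n)))"
    for n by (simp add: t_def d_def luroth_map_def Let_def)
  have partial: "(\<Sum>k<n. 1 / real (luroth_denom d (Suc k))) = x - t n / real (R n)" for n
  proof (induction n)
    case 0
    then show ?case by (simp add: t_def R_def)
  next
    case (Suc n)
    let ?a = "real (d (Suc n))"
    have a: "?a \<ge> 2" using d[of "Suc n"] by simp
    have "real (d (Suc n) * (d (Suc n) - 1)) = ?a * (?a - 1)"
      using d[of "Suc n"] by (simp add: of_nat_diff)
    then have R': "real (R (Suc n)) = real (R n) * (?a * (?a - 1))"
      by (simp only: R_Suc of_nat_mult)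
    have den: "real (luroth_denom d (Suc n)) = ?a * real (R n)"
      by (simp add: luroth_denom_def R_def)
    have "t (Suc n) / real (R (Suc n)) = (t n - 1 / ?a) / real (R n)"
      unfolding R' t_Suc using a R_pos[of n] by simp
    then show ?case
      using Suc den by (simp add: diff_divide_distrib)
  qed
  have "(\<lambda>n. t n / real (R n)) \<longlonglongrightarrow> 0"
  proof (rule tendsto_sandwich[of "\<lambda>_. 0" _ _ "\<lambda>n. (1 / 2) ^ n"])
    show "\<forall>\<^sub>F n in sequentially. 0 \<le> t n / real (R n)"
      using t R_pos by (intro always_eventually allI divide_nonneg_pos) (auto simp: less_imp_le)
    have "t n / real (R n) \<le> (1 / 2) ^ n" for n
    proof -
      have "2 ^ n \<le> real (R n)"
        using R_ge[of n] by (metis of_nat_le_iff of_nat_numeral of_nat_power)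
      then have "t n / real (R n) \<le> 1 / 2 ^ n"
        using t[of n] by (intro frac_le) auto
      then show ?thesis by (simp add: power_one_over)
    qed
    then show "\<forall>\<^sub>F n in sequentially. t n / real (R n) \<le> (1 / 2) ^ n" by simp
  qed (auto intro!: LIMSEQ_power_zero)
  then have "(\<lambda>n. x - t n / real (R n)) \<longlonglongrightarrow> x - 0"
    by (intro tendsto_intros)
  then have "(\<lambda>k. 1 / real (luroth_denom d (Suc k))) sums x"
    unfolding sums_def partial by simp
  with d show ?thesis
    unfolding luroth_expansion_def by blast
qed

theorem luroth_expansion_unique_existence:
  assumes "0 < x" "x \<le> 1"
  shows "\<exists>!d. d 0 = 0 \<and> luroth_expansion d x"
proof (rule ex_ex1I)
  obtain d where d: "luroth_expansion d x"
    using luroth_expansion_exists[OF assms] by blast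
  have "luroth_denom (d(0 := 0)) (Suc k) = luroth_denom d (Suc k)" for k
    unfolding luroth_denom_def by (intro arg_cong2[where f = "(*)"] prod.cong) auto
  with d have "luroth_expansion (d(0 := 0)) x"
    by (simp add: luroth_expansion_def)
  then show "\<exists>d. d 0 = 0 \<and> luroth_expansion d x"
    by (intro exI[of _ "d(0 := 0)"]) simp
next
  fix d e :: "nat \<Rightarrow> nat"
  assume "d 0 = 0 \<and> luroth_expansion d x" "e 0 = 0 \<and> luroth_expansion e x"
  then show "d = e"
    using luroth_expansion_unique by (metis ext not0_implies_Suc)
qed

lemma luroth_expansion_digits:
  assumes "0 < x" "x \<le> 1"
  shows "luroth_expansion (luroth_digits x) x"
  using theI'[OF luroth_expansion_unique_existence[OF assms]] by (simp add: luroth_digits_def)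

lemma mem_limsup_iff: "x \<in> limsup A \<longleftrightarrow> infinite {n :: nat. x \<in> A n}"
  by (auto simp: limsup_INF_SUP infinite_nat_iff_unbounded_le)

lemma mem_luroth_L_iff:
  "x \<in> luroth_L \<psi> \<longleftrightarrow> x \<in> {0<..1} \<and>
     infinite {n. \<bar>x - luroth_P n x / real (luroth_Q n x)\<bar>
                    < \<psi> (luroth_Q n x) / real (luroth_Q n x)}"
  unfolding luroth_L_def mem_limsup_iff by (cases "x \<in> {0<..1}") auto

end

theory Submission
  imports Defs "HOL-Computational_Algebra.Primes" "HOL-Real_Asymp.Real_Asymp"
begin

text \<open>
  For \<open>n \<ge> 2\<close> the denominator \<open>Q\<^sub>n(x)\<close> is a multiple of \<open>Q\<^sub>n\<^sub>-\<^sub>1(x)\<close> by a factor at least 2, so it is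
  composite. The values of \<open>\<psi>\<close> at primes therefore do not affect \<open>L(\<psi>)\<close>, while they can be used to
  prescribe the lower order. So take \<open>\<psi>(q) = q\<^sup>-\<^sup>\<tau>\<close> for prime \<open>q\<close> and \<open>\<psi>(q) = exp(-q)\<close> otherwise.
  As \<open>P\<^sub>n(x)\<close> is an integer in \<open>[0, Q\<^sub>n(x)]\<close>, the set \<open>L(\<psi>)\<close> is covered, for every \<open>N\<close>, by the balls
  around \<open>p/q\<close> of radius \<open>exp(-q)/q\<close> with \<open>q \<ge> N\<close> and \<open>0 \<le> p \<le> q\<close>, and the sum of
  the \<open>s\<close>-th powers of their diameters is the tail of a convergent series for every \<open>s > 0\<close>.
\<close>

section \<open>Denominators of Luroth convergents\<close>

lemma luroth_denom_Suc:
  assumes "1 \<le> n"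
  shows "luroth_denom d (Suc n) = luroth_denom d n * ((d n - 1) * d (Suc n))"
  using assms by (simp add: luroth_denom_def prod.atLeastLessThan_Suc)

lemma luroth_denom_dvd:
  assumes "1 \<le> k" "k \<le> n"
  shows "luroth_denom d k dvd luroth_denom d n"
  using assms(2)
proof (induction n rule: dec_induct)
  case (step m)
  then show ?case using assms(1) by (simp add: luroth_denom_Suc)
qed simp

text \<open>Each step multiplies the denominator by \<open>(d n - 1) * d (Suc n)\<close>, which is
  at least 2. Infinitely many indices \<open>n\<close> thus yield arbitrarily large
  denominators.\<close>

lemma luroth_denom_growth:
  assumes d: "\<forall>k\<ge>1. 2 \<le> d k" and "1 \<le> n"
  shows "n < luroth_denom d n"
  using assms(2)
proof (induction n rule: dec_induct)
  case base
  then show ?case using d[rule_format, of 1] by simp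
next
  case (step n)
  have "1 * 2 \<le> (d n - 1) * d (Suc n)"
    using d[rule_format, of n] d[rule_format, of "Suc n"] step.hyps
    by (intro mult_le_mono) auto
  then have "luroth_denom d n * 2 \<le> luroth_denom d (Suc n)"
    unfolding luroth_denom_Suc[OF step.hyps(1)] by (intro mult_le_mono) auto
  then show ?case using step.IH by linarith
qed

lemma luroth_denom_not_prime:
  assumes d: "\<forall>k\<ge>1. 2 \<le> d k" and n: "2 \<le> n"
  shows "\<not> prime (luroth_denom d n)"
proof -
  obtain m where m: "n = Suc m" "1 \<le> m"
    using n by (cases n) auto
  have "1 * 2 \<le> (d m - 1) * d (Suc m)"
    using d[rule_format, of m] d[rule_format, of "Suc m"] m(2)
    by (intro mult_le_mono) auto
  moreover have "luroth_denom d m \<noteq> 1"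
    using luroth_denom_growth[OF d m(2)] m(2) by simp
  ultimately show ?thesis
    unfolding m(1) luroth_denom_Suc[OF m(2)] by (auto dest: prime_product)
qed

text \<open>Every earlier denominator divides the last one, so clearing denominators leaves natural
  summands. The upper bound on \<open>p\<close> holds because partial sums are at most 1; it keeps
  the number of centres \<open>p/q\<close> per \<open>q\<close> finite.\<close>

lemma luroth_numerator_nat:
  assumes d: "\<forall>k\<ge>1. 2 \<le> d k"
  shows "\<exists>p\<le>luroth_denom d n.
    real (luroth_denom d n) * (\<Sum>k = 1..n. 1 / real (luroth_denom d k)) = real p"
proof -
  define q where "q = luroth_denom d n"
  have "real q * (1 / real (luroth_denom d k)) = real (q div luroth_denom d k)"
    if "k \<in> {1..n}" for k
    using luroth_denom_dvd[of k n d] that by (simp add: q_def real_of_nat_div)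
  then have eq: "real q * (\<Sum>k = 1..n. 1 / real (luroth_denom d k))
      = real (\<Sum>k = 1..n. q div luroth_denom d k)"
    by (simp add: sum_distrib_left)
  have "(\<Sum>k = 1..n. 1 / real (luroth_denom d k)) \<le> 1"
    using luroth_partial_le_1[OF d, of n]
    by (simp add: sum.atLeast1_atMost_eq)
  then have "real q * (\<Sum>k = 1..n. 1 / real (luroth_denom d k)) \<le> real q * 1"
    by (intro mult_left_mono) auto
  then have "(\<Sum>k = 1..n. q div luroth_denom d k) \<le> q"
    unfolding eq mult_1_right of_nat_le_iff .
  with eq show ?thesis unfolding q_def by blast
qed

lemma luroth_digits_ge_2:
  assumes "x \<in> {0<..1}"
  shows "\<forall>k\<ge>1. 2 \<le> luroth_digits x k"
  using luroth_expansion_digits[of x] assms by (simp add: luroth_expansion_def)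

text \<open>Forgets that \<open>p/q\<close> is a convergent and keeps only what the covering
  argument uses.\<close>

lemma luroth_L_approx:
  assumes x: "x \<in> luroth_L \<psi>"
  shows "\<exists>q\<ge>N. \<exists>p\<le>q. \<not> prime q \<and> \<bar>x - real p / real q\<bar> < \<psi> q / real q"
proof -
  have d: "\<forall>k\<ge>1. 2 \<le> luroth_digits x k"
    and inf: "infinite {n. \<bar>x - luroth_P n x / real (luroth_Q n x)\<bar>
                    < \<psi> (luroth_Q n x) / real (luroth_Q n x)}"
    using x luroth_digits_ge_2[of x] unfolding mem_luroth_L_iff by auto
  \<comment> \<open>The bound \<open>N\<close> makes the denominator large, the bound 2 makes it
    composite.\<close>
  obtain n where n: "n \<ge> max N 2"
    and lt: "\<bar>x - luroth_P n x / real (luroth_Q n x)\<bar> < \<psi> (luroth_Q n x) / real (luroth_Q n x)"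
    using inf unfolding infinite_nat_iff_unbounded_le by blast
  obtain p where "p \<le> luroth_Q n x" "luroth_P n x = real p"
    using luroth_numerator_nat[OF d, of n] by (auto simp: luroth_Q_def luroth_P_def)
  moreover have "N \<le> luroth_Q n x"
    using luroth_denom_growth[OF d, of n] n by (simp add: luroth_Q_def)
  moreover have "\<not> prime (luroth_Q n x)"
    using luroth_denom_not_prime[OF d, of n] n by (simp add: luroth_Q_def)
  ultimately show ?thesis
    using lt by (intro exI[of _ "luroth_Q n x"] conjI exI[of _ p]) auto
qed

section \<open>Null sets for Hausdorff measures\<close>

lemma hausdorff_premeasure_le:
  assumes "A \<subseteq> (\<Union>i. U i)" "\<And>i :: nat. bounded (U i) \<and> diameter (U i) \<le> \<delta>"
  shows "hausdorff_premeasure s \<delta> A \<le> (\<Sum>i. hausdorff_gauge s (U i))"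
  unfolding hausdorff_premeasure_def using assms
  by (intro Inf_lower CollectI exI[of _ U] conjI) simp_all

lemma hausdorff_gauge_le:
  assumes "s > 0" "bounded U" "diameter U \<le> r"
  shows "hausdorff_gauge s U \<le> ennreal (r powr s)"
  using assms diameter_ge_0[of U]
  by (simp add: hausdorff_gauge_def ennreal_leI powr_mono2)

text \<open>A Hausdorff-Cantelli lemma: the balls with \<open>q \<ge> N\<close> cover
  \<open>A\<close> for every \<open>N\<close>, and their total gauge is at most a tail of the
  convergent series.\<close>

lemma hausdorff_measure_limsup_rational_balls:
  fixes r :: "nat \<Rightarrow> real"
  assumes s: "s > 0" and r: "\<And>q. 0 \<le> r q" and lim: "r \<longlonglongrightarrow> 0"
    and sm: "summable (\<lambda>q. real (Suc q) * (2 * r q) powr s)"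
    and A: "\<And>x N. x \<in> A \<Longrightarrow> \<exists>q\<ge>N. \<exists>p\<le>q. \<bar>x - real p / real q\<bar> \<le> r q"
  shows "hausdorff_measure s A = 0"
proof -
  have "hausdorff_premeasure s \<delta> A = 0" if \<delta>: "\<delta> > 0" for \<delta>
  proof -
    have "hausdorff_premeasure s \<delta> A \<le> ennreal \<epsilon>" if \<epsilon>: "\<epsilon> > 0" for \<epsilon>
    proof -
      \<comment> \<open>There are \<open>q + 1\<close> centres with denominator \<open>q\<close>,
        each carrying a ball of diameter \<open>2 * r q\<close>.\<close>
      define f where "f q = real (Suc q) * (2 * r q) powr s" for q
      have f0: "0 \<le> f q" for q by (simp add: f_def)
      have "summable f" using sm unfolding f_def .
      then obtain N1 where N1: "\<bar>\<Sum>i. f (i + n)\<bar> < \<epsilon>" if "n \<ge> N1" for n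
        using suminf_exist_split[OF \<epsilon>, of f] by auto
      have "\<forall>\<^sub>F q in sequentially. r q < \<delta> / 2"
        using order_tendstoD(2)[OF lim, of "\<delta> / 2"] \<delta> by simp
      then obtain N2 where N2: "\<And>q. q \<ge> N2 \<Longrightarrow> r q < \<delta> / 2"
        by (auto simp: eventually_sequentially)
      define N where "N = max N1 N2"
      \<comment> \<open>Padding with empty sets, whose gauge is 0, makes the family range over all
        pairs, so that \<open>prod_decode\<close> can enumerate it.\<close>
      define V where "V k p = (if p \<le> k + N then cball (real p / real (k + N)) (r (k + N)) else {})"
        for k p
      define U where "U i = case_prod V (prod_decode i)" for i
      have V: "bounded (V k p) \<and> diameter (V k p) \<le> 2 * r (k + N)" for k p
        using r[of "k + N"] by (auto simp: V_def diameter_cball)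
      have U: "bounded (U i) \<and> diameter (U i) \<le> \<delta>" for i
      proof -
        obtain k p where kp: "prod_decode i = (k, p)" by fastforce
        have "2 * r (k + N) < \<delta>"
          using N2[of "k + N"] by (simp add: N_def mult.commute)
        then show ?thesis
          using V[of k p] by (simp add: U_def kp)
      qed
      have "A \<subseteq> (\<Union>i. U i)"
      proof
        fix x assume "x \<in> A"
        then obtain q p where qp: "q \<ge> N" "p \<le> q" "\<bar>x - real p / real q\<bar> \<le> r q"
          using A by blast
        then have "x \<in> U (prod_encode (q - N, p))"
          by (simp add: U_def V_def dist_real_def abs_minus_commute)
        then show "x \<in> (\<Union>i. U i)" by blast
      qed
      then have "hausdorff_premeasure s \<delta> A \<le> (\<Sum>i. hausdorff_gauge s (U i))"
        using U by (rule hausdorff_premeasure_le)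
      also have "\<dots> = (\<Sum>k. \<Sum>p. hausdorff_gauge s (V k p))"
      proof -
        have "(\<Sum>p. hausdorff_gauge s (V k p))
            = (\<Sum>p. (\<lambda>(k, p). hausdorff_gauge s (V k p)) (k, p))" for k by simp
        then show ?thesis
          by (subst suminf_ennreal_2dimen[of "\<lambda>k. \<Sum>p. hausdorff_gauge s (V k p)"
                "\<lambda>(k, p). hausdorff_gauge s (V k p)", symmetric])
            (auto simp: U_def comp_def split: prod.split intro!: suminf_cong)
      qed
      also have "\<dots> \<le> (\<Sum>k. ennreal (f (k + N)))"
      proof (rule suminf_le)
        fix k
        have "(\<Sum>p. hausdorff_gauge s (V k p)) = (\<Sum>p\<le>k + N. hausdorff_gauge s (V k p))"
          by (rule suminf_finite) (auto simp: V_def hausdorff_gauge_def)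
        also have "\<dots> \<le> (\<Sum>p\<le>k + N. ennreal ((2 * r (k + N)) powr s))"
          using V s by (intro sum_mono hausdorff_gauge_le) auto
        also have "\<dots> = ennreal (f (k + N))"
          by (subst sum_ennreal) (auto simp: f_def)
        finally show "(\<Sum>p. hausdorff_gauge s (V k p)) \<le> ennreal (f (k + N))" .
      qed auto
      also have "\<dots> = ennreal (\<Sum>k. f (k + N))"
        using \<open>summable f\<close> f0 by (intro suminf_ennreal2) (auto simp: summable_iff_shift)
      also have "\<dots> \<le> ennreal \<epsilon>"
        using N1[of N] by (intro ennreal_leI) (auto simp: N_def)
      finally show ?thesis .
    qed
    then have "hausdorff_premeasure s \<delta> A \<le> 0"
      by - (rule ennreal_le_epsilon, simp)
    then show ?thesis by simp
  qed
  then show ?thesis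
    by (simp add: hausdorff_measure_def)
qed

text \<open>The infimum is approached through small positive exponents; at exponent 0 the measure
  counts points.\<close>

lemma hausdorff_dim_eq_0:
  assumes "\<And>s. s > 0 \<Longrightarrow> hausdorff_measure s A = 0"
  shows "hausdorff_dim A = 0"
proof (rule antisym)
  show "0 \<le> hausdorff_dim A"
    unfolding hausdorff_dim_def by (rule Inf_greatest) auto
  have "hausdorff_dim A \<le> ereal e" if "e > 0" for e
    unfolding hausdorff_dim_def using assms[OF that] that by (intro Inf_lower) auto
  then show "hausdorff_dim A \<le> 0"
    by - (rule ereal_le_epsilon2, simp)
qed

section \<open>The approximating function\<close>

definition prime_spike :: "real \<Rightarrow> nat \<Rightarrow> real" where
  "prime_spike \<tau> q = (if prime q then real q powr (- \<tau>) else exp (- real q))"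

lemma prime_spike_bounds:
  assumes "\<tau> \<ge> 0"
  shows "prime_spike \<tau> q \<in> {0<..1}"
proof (cases "prime q")
  case True
  then have "1 \<le> real q" using prime_gt_0_nat[of q] by linarith
  then have "real q powr (- \<tau>) \<le> real q powr 0"
    using assms by (intro powr_mono) auto
  then show ?thesis using True \<open>1 \<le> real q\<close> by (simp add: prime_spike_def)
qed (simp add: prime_spike_def)

text \<open>The function jumps up from \<open>p - 1\<close> to \<open>p\<close> at every large prime
  \<open>p\<close>, since exponential decay beats a power.\<close>

lemma prime_spike_not_antimono: "\<not> antimono_on {N..} (prime_spike \<tau>)"
proof
  assume anti: "antimono_on {N..} (prime_spike \<tau>)"
  have "\<forall>\<^sub>F p :: nat in sequentially. exp (- (real p - 1)) < real p powr (- \<tau>)"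
    by real_asymp
  then obtain M where M: "exp (- (real p - 1)) < real p powr (- \<tau>)" if "p \<ge> M" for p :: nat
    by (auto simp: eventually_sequentially)
  \<comment> \<open>The margin puts \<open>p - 1\<close> in the tail and makes it an even number
    above 2.\<close>
  obtain p where p: "prime p" "p > N + M + 3"
    using bigger_prime by blast
  then have "odd p" using prime_odd_nat[of p] by simp
  then have "\<not> prime (p - 1)"
    using p prime_odd_nat[of "p - 1"] by fastforce
  then have "prime_spike \<tau> (p - 1) < prime_spike \<tau> p"
    using M[of p] p by (simp add: prime_spike_def of_nat_diff)
  moreover have "prime_spike \<tau> p \<le> prime_spike \<tau> (p - 1)"
    using anti p by (auto simp: monotone_on_def)
  ultimately show False by simp
qed

text \<open>The quotient equals \<tau> at primes and \<open>q / ln q\<close>, which tends to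
  infinity, elsewhere.\<close>

lemma lower_order_prime_spike: "lower_order (prime_spike \<tau>) = ereal \<tau>"
proof -
  define g where "g q = ereal (- ln (prime_spike \<tau> q) / ln (real q))" for q
  have g: "g q = ereal \<tau>" if "prime q" for q
    using that prime_gt_1_nat[OF that] by (simp add: g_def prime_spike_def ln_powr)
  have "\<forall>\<^sub>F q :: nat in sequentially. \<tau> \<le> real q / ln (real q)"
    by real_asymp
  then have "\<forall>\<^sub>F q in sequentially. ereal \<tau> \<le> g q"
  proof eventually_elim
    case (elim q)
    then show ?case using g[of q] by (cases "prime q") (auto simp: g_def prime_spike_def)
  qed
  then have "ereal \<tau> \<le> liminf g" by (rule Liminf_bounded)
  moreover have "liminf g \<le> ereal \<tau>"
    unfolding liminf_SUP_INF
  proof (rule SUP_least)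
    fix n :: nat
    obtain p where "prime p" "p > n" using bigger_prime by blast
    then show "(INF m\<in>{n..}. g m) \<le> ereal \<tau>"
      using g by (intro INF_lower2[of p]) auto
  qed
  ultimately show ?thesis
    unfolding lower_order_def g_def[symmetric] by (intro antisym)
qed

lemma hausdorff_dim_luroth_L_prime_spike: "hausdorff_dim (luroth_L (prime_spike \<tau>)) = 0"
proof (rule hausdorff_dim_eq_0)
  fix s :: real assume s: "s > 0"
  define r where "r q = exp (- real q) / real q" for q :: nat
  show "hausdorff_measure s (luroth_L (prime_spike \<tau>)) = 0"
  proof (rule hausdorff_measure_limsup_rational_balls[OF s, of r])
    show "r \<longlonglongrightarrow> 0" unfolding r_def by real_asymp
    \<comment> \<open>The factor \<open>exp (- s * q)\<close> outweighs every power of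
      \<open>q\<close>, however small \<open>s\<close> is.\<close>
    have "(\<lambda>q :: nat. real (Suc q) * (2 * r q) powr s) \<in> O(\<lambda>q. 1 / real q ^ 2)"
      unfolding r_def using s by real_asymp
    moreover have "summable (\<lambda>q :: nat. norm (1 / real q ^ 2))"
      using inverse_power_summable[of 2, where 'a = real] by (simp add: divide_inverse)
    ultimately show "summable (\<lambda>q. real (Suc q) * (2 * r q) powr s)"
      by (rule summable_comparison_test_bigo[rotated])
    fix x N assume "x \<in> luroth_L (prime_spike \<tau>)"
    then obtain q p where "q \<ge> N" "p \<le> q" "\<not> prime q"
        "\<bar>x - real p / real q\<bar> < prime_spike \<tau> q / real q"
      using luroth_L_approx by blast
    then show "\<exists>q\<ge>N. \<exists>p\<le>q. \<bar>x - real p / real q\<bar> \<le> r q"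
      by (intro exI[of _ q] conjI exI[of _ p]) (simp_all add: r_def prime_spike_def)
  qed (simp add: r_def)
qed

theorem theorem5:
  fixes \<tau> :: real
  assumes "\<tau> \<ge> 0"
  shows "\<exists>\<psi> :: nat \<Rightarrow> real.
           (\<forall>q\<ge>1. \<psi> q \<in> {0<..1}) \<and>
           \<not> (\<exists>N. antimono_on {N..} \<psi>) \<and>
           lower_order \<psi> = ereal \<tau> \<and>
           hausdorff_dim (luroth_L \<psi>) = 0 \<and>
           0 < 1 / (1 + lower_order \<psi>)"
proof (intro exI[of _ "prime_spike \<tau>"] conjI)
  \<comment> \<open>The quotient in the goal is taken in \<open>ereal\<close>; a finite lower order
    reduces it to a real one.\<close>
  have "1 / (1 + ereal \<tau>) = ereal (1 / (1 + \<tau>))"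
    using assms by (simp add: one_ereal_def)
  then show "0 < 1 / (1 + lower_order (prime_spike \<tau>))"
    using assms by (simp add: lower_order_prime_spike)
qed (use assms prime_spike_bounds prime_spike_not_antimono lower_order_prime_spike
      hausdorff_dim_luroth_L_prime_spike in auto)

end
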